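(* Let $n_o,p\ge 1$, $n_m\ge 2$, $n=n_o+n_m$, let $\mathbf{X}_o\in\mathbb{R}^{n_o\times p}$, $\mathbf{Y}_o\in\mathbb{R}^{n_o}$, and let $\mathbf{X}_m\in\mathbb{R}^{n_m\times p}$ have first $n_m-1$ rows forming the matrix $\mathbf{X}_{m-1}\in\mathbb{R}^{(n_m-1)\times p}$ and last row $\mathbf{X}_{n_m}\in\mathbb{R}^{1\times p}$. Let $T\in\mathbb{R}$ be a known total. Consider the regression model with missing responses in which the errors are multivariate normal $\mathrm{MVN}(\mathbf{0},\sigma^2\mathbf{I})$, whose likelihood $L(\boldsymbol\beta,\boldsymbol\beta_m,\sigma)$ is given in the context, subject to the constraint $\sum_{k=1}^{n_m}\beta_{m,k}=T$ on $\boldsymbol\beta_m=(\beta_{m,1},\dots,\beta_{m,n_m})^T$. Then $$\hat{\boldsymbol\beta}_{m-1}=\frac{1}{n_m}\left[\left(n_m\mathbf{I}_{n_m-1}-\mathbf{1}_{n_m-1}\mathbf{1}_{n_m-1}^T\right)\mathbf{X}_{m-1}\boldsymbol\beta-\left(\mathbf{X}_{n_m}\boldsymbol\beta-T\right)\mathbf{1}_{n_m-1}\right],\qquad \hat\beta_{n_m}=T-\mathbf{1}_{n_m-1}^T\hat{\boldsymbol\beta}_{m-1}$$ is a maximum likelihood estimate of the first $n_m-1$ entries and the last entry of $\boldsymbol\beta_m$; that is, for every $\boldsymbol\beta\in\mathbb{R}^p$ and $\sigma>0$, the vector $(\hat{\boldsymbol\beta}_{m-1}^T,\hat\beta_{n_m})^T$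 maximizes $\boldsymbol\beta_m\mapsto L(\boldsymbol\beta,\boldsymbol\beta_m,\sigma)$ over all $\boldsymbol\beta_m\in\mathbb{R}^{n_m}$ with $\sum_{k=1}^{n_m}\beta_{m,k}=T$.
   Context: A response variable has $n$ entries, of which $n_o$ are observed (vector $\mathbf{Y}_o$) and $n_m$ are missing. $\mathbf{X}_o$ and $\mathbf{X}_m$ are the (fully known) covariate matrices, possibly including an intercept column of ones, for the observations with observed and missing response, respectively. The missing responses are replaced by zeros, and an indicator column with entry $-1$ is introduced for each missing value, with coefficient vector $\boldsymbol\beta_m\in\mathbb{R}^{n_m}$ (the missing values treated as parameters). The likelihood is $$L(\boldsymbol\beta,\boldsymbol\beta_m,\sigma)=\frac{1}{(2\pi)^{n/2}\sigma^n}\exp\left(-\frac{1}{2\sigma^2}\left\|\begin{pmatrix}\mathbf{Y}_o\\ \mathbf{0}_{n_m}\end{pmatrix}-\begin{pmatrix}\mathbf{X}_o&\mathbf{0}_{n_o\times n_m}\\ \mathbf{X}_m&-\mathbf{I}_{n_m}\end{pmatrix}\begin{pmatrix}\boldsymbol\beta\\ \boldsymbol\beta_m\end{pmatrix}\right\|^2\right),$$ where $\|\cdot\|$ is the Euclidean norm. $\mathbf{1}_{k}$ is the column vector of $k$ ones and $\mathbf{I}_k$ the $k\times k$ identity matrix. *)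

theory Defs
  imports "Jordan_Normal_Form.Matrix" "HOL-Analysis.L2_Norm"
begin

definition euclidean_norm :: "real vec \<Rightarrow> real" where
  "euclidean_norm v = L2_set (\<lambda>i. v $ i) {..<dim_vec v}"

definition ones_vec :: "nat \<Rightarrow> real vec" where
  "ones_vec k = vec k (\<lambda>_. 1)"

(* 1_k * 1_k^T, with mat_of_row as the 1 x k row matrix 1_k^T *)
definition ones_outer :: "nat \<Rightarrow> real mat" where
  "ones_outer k = transpose_mat (mat_of_row (ones_vec k)) * mat_of_row (ones_vec k)"

definition augmented_response :: "real vec \<Rightarrow> nat \<Rightarrow> real vec" where
  "augmented_response Y_o n_m = Y_o @\<^sub>v 0\<^sub>v n_m"

definition augmented_design :: "real mat \<Rightarrow> real mat \<Rightarrow> real mat" where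
  "augmented_design X_o X_m =
     four_block_mat X_o (0\<^sub>m (dim_row X_o) (dim_row X_m))
                    X_m (- 1\<^sub>m (dim_row X_m))"

(* The numbers of observed and missing responses are read off as dim_vec Y_o and dim_row X_m. *)
definition likelihood ::
    "real vec \<Rightarrow> real mat \<Rightarrow> real mat \<Rightarrow> real vec \<Rightarrow> real vec \<Rightarrow> real \<Rightarrow> real" where
  "likelihood Y_o X_o X_m \<beta> \<beta>_m \<sigma> =
     (let n = dim_vec Y_o + dim_row X_m in
        1 / ((2 * pi) powr (real n / 2) * \<sigma> ^ n)
        * exp (- (1 / (2 * \<sigma>\<^sup>2))
               * (euclidean_norm (augmented_response Y_o (dim_row X_m)
                    - augmented_design X_o X_m *\<^sub>v (\<beta> @\<^sub>v \<beta>_m)))\<^sup>2))"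

(* X_init holds the rows of X_m except the last one, X_last is the last row as a 1 x p matrix;
   the index 0 turns the vector X_last * \<beta> of length one into a scalar. *)
definition beta_hat_init :: "nat \<Rightarrow> real \<Rightarrow> real mat \<Rightarrow> real mat \<Rightarrow> real vec \<Rightarrow> real vec" where
  "beta_hat_init n_m T X_init X_last \<beta> =
     (1 / real n_m) \<cdot>\<^sub>v
       ((real n_m \<cdot>\<^sub>m 1\<^sub>m (n_m - 1) - ones_outer (n_m - 1)) *\<^sub>v (X_init *\<^sub>v \<beta>)
        - ((X_last *\<^sub>v \<beta>) $ 0 - T) \<cdot>\<^sub>v ones_vec (n_m - 1))"

definition beta_hat_last :: "nat \<Rightarrow> real \<Rightarrow> real mat \<Rightarrow> real mat \<Rightarrow> real vec \<Rightarrow> real" where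
  "beta_hat_last n_m T X_init X_last \<beta> =
     T - ones_vec (n_m - 1) \<bullet> beta_hat_init n_m T X_init X_last \<beta>"

definition beta_hat :: "nat \<Rightarrow> real \<Rightarrow> real mat \<Rightarrow> real mat \<Rightarrow> real vec \<Rightarrow> real vec" where
  "beta_hat n_m T X_init X_last \<beta> =
     beta_hat_init n_m T X_init X_last \<beta> @\<^sub>v vec 1 (\<lambda>_. beta_hat_last n_m T X_init X_last \<beta>)"

end

theory Submission
  imports Defs
begin

text \<open>
  For fixed \<open>\<beta>\<close> and \<open>\<sigma>\<close> the likelihood decreases in \<open>\<parallel>\<beta>\<^sub>m - X\<^sub>m \<beta>\<parallel>\<^sup>2\<close>, so a maximizer is the
  orthogonal projection of \<open>X\<^sub>m \<beta>\<close> onto the hyperplane of vectors with entry sum \<open>T\<close>. The projection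
  subtracts the mean excess \<open>(\<Sum>k. (X\<^sub>m \<beta>)\<^sub>k - T) / n\<^sub>m\<close> from every entry, and this is what the two
  formulas for the estimate say.
\<close>

text \<open>Among families with a prescribed sum the constant one has the least sum of squares.
  Expanding the squared deviations from \<open>c\<close>, the cross term equals minus twice the sum
  of \<open>c\<^sup>2\<close> by the hypothesis, so their nonnegativity is exactly the
  claim.\<close>

lemma sum_squares_ge_mean_square:
  fixes d :: "'a \<Rightarrow> real"
  assumes "(\<Sum>k\<in>A. d k) = (\<Sum>k\<in>A. c)"
  shows "(\<Sum>k\<in>A. c\<^sup>2) \<le> (\<Sum>k\<in>A. (d k)\<^sup>2)"
proof -
  have "(\<Sum>k\<in>A. (d k - c)\<^sup>2) = (\<Sum>k\<in>A. (d k)\<^sup>2) - 2 * c * (\<Sum>k\<in>A. d k) + (\<Sum>k\<in>A. c\<^sup>2)"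
    by (simp add: power2_diff sum.distrib sum_subtractf sum_distrib_left sum_distrib_right mult_ac)
  also have "\<dots> = (\<Sum>k\<in>A. (d k)\<^sup>2) - (\<Sum>k\<in>A. c\<^sup>2)"
    unfolding assms by (simp add: power2_eq_square)
  finally show ?thesis
    using sum_nonneg[of A "\<lambda>k. (d k - c)\<^sup>2"] by simp
qed

lemma euclidean_norm_square: "(euclidean_norm v)\<^sup>2 = (\<Sum>i<dim_vec v. (v $ i)\<^sup>2)"
  by (simp add: euclidean_norm_def L2_set_def sum_nonneg)

lemma euclidean_norm_append_square:
  "(euclidean_norm (v @\<^sub>v w))\<^sup>2 = (euclidean_norm v)\<^sup>2 + (euclidean_norm w)\<^sup>2"
  by (simp add: euclidean_norm_square lessThan_atLeast0 sum.atLeastLessThan_concat[symmetric,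
      of 0 "dim_vec v" "dim_vec v + dim_vec w"] sum.atLeastLessThan_shift_0[of _ "dim_vec v"])

text \<open>The block form separates the parameters: the zero block keeps \<open>\<beta>_m\<close>
  out of the observed residual, and the block of entries -1 together with the zero responses leaves
  \<open>\<beta>_m\<close> minus its fitted value in the rest.\<close>

lemma residual_eq:
  assumes X_o: "X_o \<in> carrier_mat n_o p" and Y_o: "Y_o \<in> carrier_vec n_o"
    and X_m: "X_m \<in> carrier_mat n_m p"
    and \<beta>: "\<beta> \<in> carrier_vec p" and \<beta>_m: "\<beta>_m \<in> carrier_vec n_m"
  shows "augmented_response Y_o n_m - augmented_design X_o X_m *\<^sub>v (\<beta> @\<^sub>v \<beta>_m) =
    (Y_o - X_o *\<^sub>v \<beta>) @\<^sub>v (\<beta>_m - X_m *\<^sub>v \<beta>)"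
proof -
  have "augmented_design X_o X_m *\<^sub>v (\<beta> @\<^sub>v \<beta>_m) =
      (X_o *\<^sub>v \<beta> + 0\<^sub>m n_o n_m *\<^sub>v \<beta>_m) @\<^sub>v (X_m *\<^sub>v \<beta> + (- 1\<^sub>m n_m) *\<^sub>v \<beta>_m)"
    unfolding augmented_design_def using assms
    by (subst four_block_mat_mult_vec[where ?nr1.0 = n_o and ?nc1.0 = p and ?nr2.0 = n_m and ?nc2.0 = n_m]) auto
  also have "\<dots> = X_o *\<^sub>v \<beta> @\<^sub>v (X_m *\<^sub>v \<beta> - \<beta>_m)"
    using assms by (intro arg_cong2[where f = append_vec] eq_vecI) auto
  finally show ?thesis
    using assms by (intro eq_vecI) (auto simp: augmented_response_def)
qed

text \<open>The positive normalizing constant and the observed residual agree on both sides and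
  cancel. The order is reversed because the exponent carries the negative factor
  \<open>- (1 / (2 * \<sigma>\<^sup>2))\<close>.\<close>

lemma likelihood_le_iff:
  assumes "X_o \<in> carrier_mat n_o p" and "Y_o \<in> carrier_vec n_o"
    and "X_m \<in> carrier_mat n_m p"
    and "\<beta> \<in> carrier_vec p" and "b \<in> carrier_vec n_m" and "b' \<in> carrier_vec n_m"
    and "0 < \<sigma>"
  shows "likelihood Y_o X_o X_m \<beta> b \<sigma> \<le> likelihood Y_o X_o X_m \<beta> b' \<sigma> \<longleftrightarrow>
    (euclidean_norm (b' - X_m *\<^sub>v \<beta>))\<^sup>2 \<le> (euclidean_norm (b - X_m *\<^sub>v \<beta>))\<^sup>2"
proof -
  define K where "K = 1 / ((2 * pi) powr (real (n_o + n_m) / 2) * \<sigma> ^ (n_o + n_m))"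
  have "0 < K"
    using \<open>0 < \<sigma>\<close> by (simp add: K_def)
  have L: "likelihood Y_o X_o X_m \<beta> x \<sigma> =
      K * exp (- (1 / (2 * \<sigma>\<^sup>2)) *
        ((euclidean_norm (Y_o - X_o *\<^sub>v \<beta>))\<^sup>2 + (euclidean_norm (x - X_m *\<^sub>v \<beta>))\<^sup>2))"
    if "x \<in> carrier_vec n_m" for x
    using assms that residual_eq[OF assms(1-4) that]
    by (auto simp: likelihood_def K_def Let_def euclidean_norm_append_square)
  show ?thesis
    unfolding L[OF assms(5)] L[OF assms(6)] using \<open>0 < K\<close> \<open>0 < \<sigma>\<close>
    by (simp add: divide_le_cancel)
qed

lemma ones_outer_mult_vec:
  assumes "v \<in> carrier_vec k"
  shows "ones_outer k *\<^sub>v v = (\<Sum>i<k. v $ i) \<cdot>\<^sub>v ones_vec k"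
proof (rule eq_vecI)
  fix j assume "j < dim_vec ((\<Sum>i<k. v $ i) \<cdot>\<^sub>v ones_vec k)"
  then have "j < k"
    by (simp add: ones_vec_def)
  have "ones_outer k = mat k k (\<lambda>_. 1)"
    by (rule eq_matI) (auto simp: ones_outer_def ones_vec_def mat_of_row_def scalar_prod_def)
  with assms \<open>j < k\<close> show "(ones_outer k *\<^sub>v v) $ j = ((\<Sum>i<k. v $ i) \<cdot>\<^sub>v ones_vec k) $ j"
    by (simp add: ones_vec_def scalar_prod_def lessThan_atLeast0)
qed (simp add: ones_outer_def ones_vec_def mat_of_row_def)

text \<open>The formulas for the estimate single out the last coordinate, eliminated through the
  constraint. This closed form treats all coordinates alike, which exposes the estimate as a
  constant shift of the fitted values \<open>z\<close>.\<close>

lemma beta_hat_eq: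
  assumes n_m: "1 \<le> n_m"
    and X_init: "X_init \<in> carrier_mat (n_m - 1) p" and X_last: "X_last \<in> carrier_mat 1 p"
    and \<beta>: "\<beta> \<in> carrier_vec p"
    and z: "z = (X_init @\<^sub>r X_last) *\<^sub>v \<beta>"
  shows "beta_hat n_m T X_init X_last \<beta> =
    vec n_m (\<lambda>k. z $ k - ((\<Sum>k<n_m. z $ k) - T) / real n_m)"
proof -
  define m where "m = n_m - 1"
  have n_m_eq: "n_m = Suc m"
    using n_m by (simp add: m_def)
  define u where "u = X_init *\<^sub>v \<beta>"
  define a where "a = (X_last *\<^sub>v \<beta>) $ 0"
  define S where "S = (\<Sum>k<m. u $ k)"
  have u: "u \<in> carrier_vec m"
    using X_init \<beta> by (simp add: u_def m_def)
  have "z = u @\<^sub>v (X_last *\<^sub>v \<beta>)"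
    unfolding z u_def using mat_mult_append[OF X_init X_last \<beta>] .
  then have z_init: "\<And>k. k < m \<Longrightarrow> z $ k = u $ k" and z_last: "z $ m = a"
    using u X_last by (auto simp: a_def)
  have sum_z: "(\<Sum>k<n_m. z $ k) = S + a"
    by (simp add: n_m_eq S_def z_init z_last)
  have init: "beta_hat_init n_m T X_init X_last \<beta> = vec m (\<lambda>k. u $ k - (S + a - T) / real n_m)"
  proof (rule eq_vecI)
    fix k assume "k < dim_vec (vec m (\<lambda>k. u $ k - (S + a - T) / real n_m))"
    then have "k < m"
      by simp
    have scale: "(real n_m \<cdot>\<^sub>m 1\<^sub>m m) *\<^sub>v u = real n_m \<cdot>\<^sub>v u"
      using u by (intro eq_vecI) auto
    have "(real n_m \<cdot>\<^sub>m 1\<^sub>m m - ones_outer m) *\<^sub>v u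
        = (real n_m \<cdot>\<^sub>m 1\<^sub>m m) *\<^sub>v u - ones_outer m *\<^sub>v u"
      using u by (intro minus_mult_distrib_mat_vec[where nr = m and nc = m])
        (auto simp: ones_outer_def ones_vec_def mat_of_row_def)
    also have "\<dots> = real n_m \<cdot>\<^sub>v u - S \<cdot>\<^sub>v ones_vec m"
      using u by (simp add: scale ones_outer_mult_vec S_def)
    finally have "beta_hat_init n_m T X_init X_last \<beta> =
        (1 / real n_m) \<cdot>\<^sub>v (real n_m \<cdot>\<^sub>v u - S \<cdot>\<^sub>v ones_vec m - (a - T) \<cdot>\<^sub>v ones_vec m)"
      by (simp add: beta_hat_init_def u_def a_def m_def)
    then show "beta_hat_init n_m T X_init X_last \<beta> $ k = vec m (\<lambda>k. u $ k - (S + a - T) / real n_m) $ k"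
      using \<open>k < m\<close> u n_m by (simp add: ones_vec_def field_simps)
  qed (simp add: beta_hat_init_def ones_vec_def m_def)
  have "beta_hat_last n_m T X_init X_last \<beta> = T - (S - real m * ((S + a - T) / real n_m))"
    unfolding beta_hat_last_def init m_def[symmetric]
    by (simp add: ones_vec_def scalar_prod_def lessThan_atLeast0 S_def sum_subtractf)
  \<comment> \<open>With e the subtracted quotient, (m + 1) e = S + a - T, so T - S + m e = a - e:
    the last entry gets the same shift as the others.\<close>
  also have "\<dots> = a - (S + a - T) / real n_m"
    by (simp add: n_m_eq field_simps)
  finally have last: "beta_hat_last n_m T X_init X_last \<beta> = a - (S + a - T) / real n_m" .
  show ?thesis
    unfolding beta_hat_def init last sum_z
    by (rule eq_vecI) (auto simp: n_m_eq less_Suc_eq z_init z_last)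
qed

theorem theorem6:
  fixes n_o n_m p :: nat
    and X_o X_m X_init X_last :: "real mat"
    and Y_o :: "real vec"
    and T :: real
  assumes "1 \<le> n_o" and "1 \<le> p" and "2 \<le> n_m"
    and "X_o \<in> carrier_mat n_o p"
    and "Y_o \<in> carrier_vec n_o"
    and "X_m \<in> carrier_mat n_m p"
    and "X_init \<in> carrier_mat (n_m - 1) p"
    and "X_last \<in> carrier_mat 1 p"
    and "X_m = X_init @\<^sub>r X_last"
  shows "\<forall>\<beta> \<in> carrier_vec p. \<forall>\<sigma>. 0 < \<sigma> \<longrightarrow>
    is_arg_max (\<lambda>\<beta>_m. likelihood Y_o X_o X_m \<beta> \<beta>_m \<sigma>)
      (\<lambda>\<beta>_m. \<beta>_m \<in> carrier_vec n_m \<and> (\<Sum>k<n_m. \<beta>_m $ k) = T)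
      (beta_hat n_m T X_init X_last \<beta>)"
proof (intro ballI allI impI)
  fix \<beta> :: "real vec" and \<sigma> :: real
  assume \<beta>: "\<beta> \<in> carrier_vec p" and \<sigma>: "0 < \<sigma>"
  define z where "z = X_m *\<^sub>v \<beta>"
  \<comment> \<open>The only constant that, added to every entry of \<open>z\<close>, brings the sum
    to \<open>T\<close>.\<close>
  define c where "c = (T - (\<Sum>k<n_m. z $ k)) / real n_m"
  let ?b = "beta_hat n_m T X_init X_last \<beta>"
  have "dim_vec z = n_m"
    using assms(6) by (simp add: z_def)
  have b: "?b = vec n_m (\<lambda>k. z $ k + c)"
    using assms beta_hat_eq[of n_m X_init p X_last \<beta> z T] \<beta>
    by (auto simp: z_def c_def diff_divide_distrib)
  have sum_c: "(\<Sum>k<n_m. c) = T - (\<Sum>k<n_m. z $ k)"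
    using \<open>2 \<le> n_m\<close> by (simp add: c_def)
  have "(\<Sum>k<n_m. ?b $ k) = T"
    using sum_c by (simp add: b sum.distrib)
  moreover have "likelihood Y_o X_o X_m \<beta> x \<sigma> \<le> likelihood Y_o X_o X_m \<beta> ?b \<sigma>"
    if x: "x \<in> carrier_vec n_m" and "(\<Sum>k<n_m. x $ k) = T" for x
  proof -
    \<comment> \<open>Both \<open>?b\<close> and \<open>x\<close> have entry sum \<open>T\<close>,
      so their differences from \<open>z\<close> have equal sums, and that of \<open>?b\<close> is
      constant.\<close>
    have "(euclidean_norm (?b - z))\<^sup>2 = (\<Sum>k<n_m. c\<^sup>2)"
      by (simp add: euclidean_norm_square b \<open>dim_vec z = n_m\<close>)
    also have "\<dots> \<le> (\<Sum>k<n_m. (x $ k - z $ k)\<^sup>2)"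
      using that sum_c by (intro sum_squares_ge_mean_square) (simp add: sum_subtractf)
    also have "\<dots> = (euclidean_norm (x - z))\<^sup>2"
      by (simp add: euclidean_norm_square \<open>dim_vec z = n_m\<close>)
    finally show ?thesis
      using likelihood_le_iff[OF assms(4-6) \<beta> x _ \<sigma>, of ?b] by (simp add: b z_def)
  qed
  ultimately show "is_arg_max (\<lambda>\<beta>_m. likelihood Y_o X_o X_m \<beta> \<beta>_m \<sigma>)
      (\<lambda>\<beta>_m. \<beta>_m \<in> carrier_vec n_m \<and> (\<Sum>k<n_m. \<beta>_m $ k) = T) ?b"
    by (auto simp: is_arg_max_def not_less b)
qed

end
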